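(* Let $I$ be a monomial ideal and $>_I$ a total ordering on $\mathcal G(I)$. Assume there exist no two subsets $\sigma$ and $\tau$ of $\mathcal G(I)$ (for which $\operatorname{sb}(\sigma),\operatorname{sb}(\tau),m_L(\sigma),m_L(\tau)$ exist) such that $\sigma\setminus\operatorname{sb}(\sigma)=\tau\setminus\operatorname{sb}(\tau)$, $\operatorname{sb}(\tau)>_I\operatorname{sb}(\sigma)$, $m_L(\sigma)=m_L(\tau)>_I\operatorname{sb}(\tau)$, and $m_L(\tau)\in\tau$. Then $V_L\subseteq V_B$. In particular, $\operatorname{rank}(\mathcal F_L)_i\ge\operatorname{rank}(\mathcal F_B)_i$ for each $i\in\mathbb Z$, where $\mathcal F_L$ and $\mathcal F_B$ are the Lyubeznik and Barile-Macchia resolutions of $R/I$ induced by $>_I$, respectively.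
   Context: Let $R=\Bbbk[x_1,\dots,x_N]$ over a field, $I\subseteq R$ a monomial ideal with minimal monomial generating set $\mathcal G(I)$ totally ordered by $>_I$. Directed edges are pairs $(\sigma,\sigma')$ of subsets of $\mathcal G(I)$ with $\sigma'\subseteq\sigma$, $|\sigma'|=|\sigma|-1$. Lyubeznik matching $A_L$. For $\sigma=\{m_1>_I\cdots>_Im_p\}\subseteq\mathcal G(I)$ let $v_L(\sigma)=\sup\{k\in[p]:\exists m\in\mathcal G(I)\text{ with } m_k>_Im\text{ and } m\mid\operatorname{lcm}(m_1,\dots,m_k)\}$ ($-\infty$ if there is no such $k$). If $v_L(\sigma)\neq-\infty$ (in which case we say $m_L(\sigma)$ exists) let $m_L(\sigma)$ be the $>_I$-smallest $m\in\mathcal G(I)$ with $m\mid\operatorname{lcm}(m_1,\dots,m_{v_L(\sigma)})$. Put $A_L=\{(\sigma\cup m_L(\sigma),\sigma\setminus m_L(\sigma)): \sigma\subseteq\mathcal G(I),\ v_L(\sigma)\neq-\infty\}$. Barile-Macchia matching $A_B$. $m$ is a bridge of $\sigma$ if $m\in\sigma$ and $\operatorname{lcm}(\sigma\setminus m)=\operatorname{lcm}(\sigma)$; $\operatorname{sb}(\sigma)$ is the $>_I$-smallest bridge of $\sigma$, or $\emptyset$ if there is none (we say $\operatorname{sb}(\sigma)$ exists if $\sigma$ has a bridge; $\sigma\setminus\emptyset=\sigma$). Start with $A=\emptyset$, $\Omega=\{\sigma\subseteq\mathcal G(I):|\sigma|\ge3\}$. (1) Pick $\sigma\in\Omega$ of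 maximal cardinality. (2) Replace $\Omega$ by $\Omega\setminus\{\sigma,\sigma\setminus\operatorname{sb}(\sigma)\}$; if $\operatorname{sb}(\sigma)\ne\emptyset$ add $(\sigma,\sigma\setminus\operatorname{sb}(\sigma))$ to $A$; if $\Omega\ne\emptyset$ return to (1). (3) Whenever two distinct edges $(\sigma,\sigma\setminus\operatorname{sb}(\sigma))$, $(\sigma',\sigma'\setminus\operatorname{sb}(\sigma'))$ of $A$ have the same target, remove the one whose smallest bridge is larger w.r.t. $>_I$. The result is $A_B$. Both $A_L$ and $A_B$ are $\operatorname{lcm}$-homogeneous acyclic matchings, and by discrete Morse theory (Batzies–Welker) they induce free resolutions $\mathcal F_L$ and $\mathcal F_B$ of $R/I$ in which the module in homological degree $i$ is free with basis the critical subsets of cardinality $i$, i.e. those subsets of $\mathcal G(I)$ of cardinality $i$ that appear in no edge of $A_L$ (resp. $A_B$). $V_L$ (resp. $V_B$) is the set of all subsets of $\mathcal G(I)$ that appear in some edge (as source or target) of $A_L$ (resp. $A_B$). *)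

theory Defs
  imports Complex_Main "HOL-Library.Poly_Mapping"
begin

section \<open>The polynomial ring and monomial ideals\<close>

text \<open>
  The variables are the elements of a finite type \<open>'x\<close>.  A monomial is identified with its exponent
  vector, so that multiplication of monomials is \<open>+\<close> and the monomial \<open>1\<close> is \<open>0\<close>; the polynomial
  ring over \<open>'k\<close> is the monoid algebra of the monomials.
\<close>

type_synonym 'x mon = "'x \<Rightarrow>\<^sub>0 nat"
type_synonym ('x, 'k) mpoly = "'x mon \<Rightarrow>\<^sub>0 'k"

definition monom :: "'x mon \<Rightarrow> ('x, 'k::field) mpoly" where
  "monom m = Poly_Mapping.single m 1"

definition mon_dvd :: "'x mon \<Rightarrow> 'x mon \<Rightarrow> bool" where
  "mon_dvd m n \<longleftrightarrow> (\<exists>c. n = m + c)"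

text \<open>Inserting \<open>0\<close> only affects the empty set, whose least common multiple is \<open>1\<close>.\<close>

definition mon_lcm :: "'x::finite mon set \<Rightarrow> 'x mon" where
  "mon_lcm \<sigma> = Abs_poly_mapping (\<lambda>x. Max (insert 0 ((\<lambda>m. Poly_Mapping.lookup m x) ` \<sigma>)))"

lemma lookup_mon_lcm:
  "Poly_Mapping.lookup (mon_lcm \<sigma>) x = Max (insert 0 ((\<lambda>m. Poly_Mapping.lookup m x) ` \<sigma>))"
  by (simp add: mon_lcm_def)

text \<open>
  The ideal generated by a set is its span in the ring regarded as a module over itself.  This module
  is deliberately not interpreted globally: its simp rules would make \<open>algebra_simps\<close> loop.
\<close>

lemma module_mult: "module ((*) :: 'r::comm_ring_1 \<Rightarrow> 'r \<Rightarrow> 'r)"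
  by unfold_locales (simp_all add: algebra_simps)

definition ideal_generated :: "'r::comm_ring_1 set \<Rightarrow> 'r set" where
  "ideal_generated = module.span (*)"

definition monomial_ideal :: "('x, 'k::field) mpoly set \<Rightarrow> bool" where
  "monomial_ideal I \<longleftrightarrow> (\<exists>S. I = ideal_generated (monom ` S))"

definition minimal_monomial_generators ::
    "('x, 'k::field) mpoly set \<Rightarrow> 'x mon set \<Rightarrow> bool" where
  "minimal_monomial_generators I G \<longleftrightarrow>
     I = ideal_generated (monom ` G) \<and>
     (\<forall>G'. G' \<subset> G \<longrightarrow> ideal_generated (monom ` G') \<noteq> I)"

section \<open>Total orders on the generators\<close>

text \<open>Throughout, \<open>gt m n\<close> stands for \<open>m >\<^sub>I n\<close>.\<close>

definition strict_total_order_on :: "'a set \<Rightarrow> ('a \<Rightarrow> 'a \<Rightarrow> bool) \<Rightarrow> bool" where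
  "strict_total_order_on G gt \<longleftrightarrow> irreflp_on G gt \<and> transp_on G gt \<and> totalp_on G gt"

definition smallest :: "('a \<Rightarrow> 'a \<Rightarrow> bool) \<Rightarrow> 'a set \<Rightarrow> 'a" where
  "smallest gt S = (THE m. m \<in> S \<and> (\<forall>n\<in>S. n \<noteq> m \<longrightarrow> gt n m))"

definition decreasing_list :: "('a \<Rightarrow> 'a \<Rightarrow> bool) \<Rightarrow> 'a set \<Rightarrow> 'a list" where
  "decreasing_list gt \<sigma> = (THE l. sorted_wrt gt l \<and> set l = \<sigma>)"

section \<open>The Lyubeznik matching\<close>

text \<open>
  \<open>m\<^sub>k\<close> is \<open>decreasing_list gt \<sigma> ! (k - 1)\<close>, the indices being shifted by one.
  The value \<open>-\<infinity>\<close> of \<open>v\<^sub>L\<close> is rendered as \<open>None\<close>.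
\<close>

definition v_L :: "'x::finite mon set \<Rightarrow> ('x mon \<Rightarrow> 'x mon \<Rightarrow> bool) \<Rightarrow> 'x mon set \<Rightarrow> nat option" where
  "v_L G gt \<sigma> =
     (let l = decreasing_list gt \<sigma>;
          K = {k \<in> {1..length l}. \<exists>m\<in>G. gt (l ! (k - 1)) m \<and> mon_dvd m (mon_lcm (set (take k l)))}
      in if K = {} then None else Some (Max K))"

definition m_L :: "'x::finite mon set \<Rightarrow> ('x mon \<Rightarrow> 'x mon \<Rightarrow> bool) \<Rightarrow> 'x mon set \<Rightarrow> 'x mon option" where
  "m_L G gt \<sigma> =
     (case v_L G gt \<sigma> of
        None \<Rightarrow> None
      | Some v \<Rightarrow>
          Some (smallest gt {m \<in> G. mon_dvd m (mon_lcm (set (take v (decreasing_list gt \<sigma>))))}))"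

definition lyubeznik_matching ::
    "'x::finite mon set \<Rightarrow> ('x mon \<Rightarrow> 'x mon \<Rightarrow> bool) \<Rightarrow> ('x mon set \<times> 'x mon set) set" where
  "lyubeznik_matching G gt =
     {(\<sigma> \<union> {m}, \<sigma> - {m}) | \<sigma> m. \<sigma> \<subseteq> G \<and> m_L G gt \<sigma> = Some m}"

section \<open>The Barile--Macchia matching\<close>

definition bridges :: "'x::finite mon set \<Rightarrow> 'x mon set" where
  "bridges \<sigma> = {m \<in> \<sigma>. mon_lcm (\<sigma> - {m}) = mon_lcm \<sigma>}"

definition sb :: "('x::finite mon \<Rightarrow> 'x mon \<Rightarrow> bool) \<Rightarrow> 'x mon set \<Rightarrow> 'x mon option" where
  "sb gt \<sigma> = (if bridges \<sigma> = {} then None else Some (smallest gt (bridges \<sigma>)))"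

text \<open>The set \<open>\<sigma> \<setminus> sb(\<sigma>)\<close>, which is \<open>\<sigma>\<close> if there is no bridge.\<close>

definition remove_sb :: "('x::finite mon \<Rightarrow> 'x mon \<Rightarrow> bool) \<Rightarrow> 'x mon set \<Rightarrow> 'x mon set" where
  "remove_sb gt \<sigma> = \<sigma> - set_option (sb gt \<sigma>)"

text \<open>
  The states \<open>(\<Omega>, A)\<close> that the algorithm can reach.  The choice of \<open>\<sigma>\<close> in the first step is
  nondeterministic.
\<close>

inductive bm_reaches ::
    "'x::finite mon set \<Rightarrow> ('x mon \<Rightarrow> 'x mon \<Rightarrow> bool) \<Rightarrow>
     'x mon set set \<Rightarrow> ('x mon set \<times> 'x mon set) set \<Rightarrow> bool"
  for G gt where
  start: "bm_reaches G gt {\<sigma>. \<sigma> \<subseteq> G \<and> card \<sigma> \<ge> 3} {}"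
| step: "bm_reaches G gt \<Omega> A \<Longrightarrow> \<sigma> \<in> \<Omega> \<Longrightarrow> (\<And>\<tau>. \<tau> \<in> \<Omega> \<Longrightarrow> card \<tau> \<le> card \<sigma>) \<Longrightarrow>
     bm_reaches G gt (\<Omega> - {\<sigma>, remove_sb gt \<sigma>})
       (if sb gt \<sigma> = None then A else insert (\<sigma>, remove_sb gt \<sigma>) A)"

definition bm_prune ::
    "('x::finite mon \<Rightarrow> 'x mon \<Rightarrow> bool) \<Rightarrow> ('x mon set \<times> 'x mon set) set \<Rightarrow>
     ('x mon set \<times> 'x mon set) set" where
  "bm_prune gt A =
     {(\<sigma>, \<tau>) \<in> A. \<not> (\<exists>\<sigma>'. (\<sigma>', \<tau>) \<in> A \<and> gt (the (sb gt \<sigma>)) (the (sb gt \<sigma>')))}"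

definition barile_macchia_matching ::
    "'x::finite mon set \<Rightarrow> ('x mon \<Rightarrow> 'x mon \<Rightarrow> bool) \<Rightarrow> ('x mon set \<times> 'x mon set) set \<Rightarrow> bool" where
  "barile_macchia_matching G gt B \<longleftrightarrow> (\<exists>A. bm_reaches G gt {} A \<and> B = bm_prune gt A)"

lemma barile_macchia_matching_exists:
  assumes "finite G"
  shows "\<exists>B. barile_macchia_matching G gt B"
proof -
  have "\<exists>A'. bm_reaches G gt {} A'" if "bm_reaches G gt \<Omega> A" "finite \<Omega>" for \<Omega> A
    using that(2,1)
  proof (induction \<Omega> arbitrary: A rule: finite_psubset_induct)
    case (psubset \<Omega>)
    show ?case
    proof (cases "\<Omega> = {}")
      case True
      then show ?thesis using psubset.prems by blast
    next
      case False
      have "Max (card ` \<Omega>) \<in> card ` \<Omega>"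
        using psubset.hyps False by (intro Max_in) auto
      then obtain \<sigma> where "\<sigma> \<in> \<Omega>" "card \<sigma> = Max (card ` \<Omega>)"
        by auto
      then have \<sigma>: "\<sigma> \<in> \<Omega>" "\<And>\<tau>. \<tau> \<in> \<Omega> \<Longrightarrow> card \<tau> \<le> card \<sigma>"
        using psubset.hyps by auto
      show ?thesis
        by (rule psubset.IH[OF _ bm_reaches.step[OF psubset.prems \<sigma>]]) (use \<sigma>(1) in auto)
    qed
  qed
  from this[OF bm_reaches.start] assms show ?thesis
    unfolding barile_macchia_matching_def by auto
qed

section \<open>The resolution induced by a matching\<close>

text \<open>
  \<open>Field A\<close> is the set of all subsets that are the source or the target of an edge of \<open>A\<close>.
\<close>

definition critical :: "'a set \<Rightarrow> ('a set \<times> 'a set) set \<Rightarrow> int \<Rightarrow> 'a set set" where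
  "critical G A i = {\<sigma>. \<sigma> \<subseteq> G \<and> int (card \<sigma>) = i \<and> \<sigma> \<notin> Field A}"

text \<open>The signs of the Taylor complex, for \<open>\<sigma>' = \<sigma> - {m}\<close> with \<open>m \<in> \<sigma>\<close>.\<close>

definition incidence :: "('a \<Rightarrow> 'a \<Rightarrow> bool) \<Rightarrow> 'a set \<Rightarrow> 'a set \<Rightarrow> int" where
  "incidence gt \<sigma> \<sigma>' = (-1) ^ card {n \<in> \<sigma>. \<exists>m \<in> \<sigma> - \<sigma>'. gt n m}"

definition facets :: "'a set \<Rightarrow> 'a set set" where
  "facets \<sigma> = {\<sigma> - {m} | m. m \<in> \<sigma>}"

text \<open>The directed graph obtained from that of all directed edges by reversing the edges in \<open>A\<close>.\<close>

definition reversed_graph :: "'a set \<Rightarrow> ('a set \<times> 'a set) set \<Rightarrow> ('a set \<times> 'a set) set" where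
  "reversed_graph G A = ({(\<sigma>, \<sigma>'). \<sigma> \<subseteq> G \<and> \<sigma>' \<in> facets \<sigma>} - A) \<union> A\<inverse>"

definition gradient_paths ::
    "'a set \<Rightarrow> ('a set \<times> 'a set) set \<Rightarrow> 'a set \<Rightarrow> 'a set \<Rightarrow> 'a set list set" where
  "gradient_paths G A \<sigma> \<tau> =
     {P. P \<noteq> [] \<and> hd P = \<sigma> \<and> last P = \<tau> \<and> successively (\<lambda>a b. (a, b) \<in> reversed_graph G A) P}"

fun path_coeff :: "('a \<Rightarrow> 'a \<Rightarrow> bool) \<Rightarrow> ('a set \<times> 'a set) set \<Rightarrow> 'a set list \<Rightarrow> int" where
  "path_coeff gt A (a # b # P) =
     (if (b, a) \<in> A then - incidence gt b a else incidence gt a b) * path_coeff gt A (b # P)"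
| "path_coeff gt A P = 1"

text \<open>
  Elements of the free module on the subsets of the generators are finitely supported families of
  polynomials.
\<close>

type_synonym ('x, 'k) free_mod = "'x mon set \<Rightarrow>\<^sub>0 ('x, 'k) mpoly"

definition scale_free :: "'r::comm_ring_1 \<Rightarrow> ('b \<Rightarrow>\<^sub>0 'r) \<Rightarrow> ('b \<Rightarrow>\<^sub>0 'r)" where
  "scale_free r f = Poly_Mapping.map ((*) r) f"

lemma lookup_scale_free: "Poly_Mapping.lookup (scale_free r f) b = r * Poly_Mapping.lookup f b"
  by (simp add: scale_free_def map.rep_eq when_def)

global_interpretation free_module: module "scale_free :: 'r::comm_ring_1 \<Rightarrow> ('b \<Rightarrow>\<^sub>0 'r) \<Rightarrow> _"
  by unfold_locales
    (rule poly_mapping_eqI, simp add: lookup_scale_free lookup_add algebra_simps)+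

record 'm graded_complex =
  component :: "int \<Rightarrow> 'm set"
  differential :: "int \<Rightarrow> 'm \<Rightarrow> 'm"

text \<open>
  The image of the basis element of a critical subset \<open>\<sigma>\<close> of cardinality \<open>i\<close>; the subtraction of
  exponent vectors is the division \<open>lcm(\<sigma>) / lcm(\<sigma>'')\<close>.
\<close>

definition morse_boundary ::
    "'x::finite mon set \<Rightarrow> ('x mon \<Rightarrow> 'x mon \<Rightarrow> bool) \<Rightarrow> ('x mon set \<times> 'x mon set) set \<Rightarrow>
     int \<Rightarrow> 'x mon set \<Rightarrow> ('x, 'k::field) free_mod" where
  "morse_boundary G gt A i \<sigma> =
     (\<Sum>\<sigma>' \<in> facets \<sigma>. \<Sum>\<sigma>'' \<in> critical G A (i - 1). \<Sum>P \<in> gradient_paths G A \<sigma>' \<sigma>''.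
        Poly_Mapping.single \<sigma>''
          (of_int (incidence gt \<sigma> \<sigma>' * path_coeff gt A P) * monom (mon_lcm \<sigma> - mon_lcm \<sigma>'')))"

definition morse_resolution ::
    "'x::finite mon set \<Rightarrow> ('x mon \<Rightarrow> 'x mon \<Rightarrow> bool) \<Rightarrow> ('x mon set \<times> 'x mon set) set \<Rightarrow>
     ('x, 'k::field) free_mod graded_complex" where
  "morse_resolution G gt A =
     \<lparr>component = (\<lambda>i. {f. Poly_Mapping.keys f \<subseteq> critical G A i}),
      differential = (\<lambda>i f. \<Sum>\<sigma> \<in> Poly_Mapping.keys f.
        scale_free (Poly_Mapping.lookup f \<sigma>) (morse_boundary G gt A i \<sigma>))\<rparr>"

text \<open>The rank of a finitely generated free submodule \<open>M\<close>: the cardinality of any of its bases.\<close>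

definition free_rank :: "('b \<Rightarrow>\<^sub>0 'r::comm_ring_1) set \<Rightarrow> nat" where
  "free_rank M = card (SOME B. free_module.independent B \<and> free_module.span B = M)"

end

theory Submission
  imports Defs
begin

text \<open>
  Write \<open>\<sigma>[m]\<close> for the elements of \<open>\<sigma>\<close> above \<open>m\<close>.  Two descriptions free the matchings from the
  algorithms that define them.

  \<^item> \<open>m\<^sub>L(\<sigma>)\<close> is the smallest generator \<open>m\<close> with \<open>\<sigma>[m]\<close> nonempty and \<open>m\<close> dividing \<open>lcm(\<sigma>[m])\<close>
    (\<open>m_L_eq_Some_iff\<close>).  Inserting or deleting \<open>m = m\<^sub>L(\<sigma>)\<close> changes neither \<open>m\<^sub>L\<close> nor the bridges
    below \<open>m\<close>, and \<open>\<sigma>\<close> is in \<open>V\<^sub>L\<close> exactly if \<open>m\<^sub>L(\<sigma>)\<close> exists.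
  \<^item> Before pruning, a set with at least two elements is a target as soon as it has the form
    \<open>\<rho> \<setminus> sb(\<rho>)\<close> with \<open>sb(\<rho>)\<close> defined (\<open>extends_by_sb_in_Range\<close>), and every set with at least
    three elements and a bridge that is not a target is a source.  Pruning loses no target, and loses
    a source only to a rival source with the same target and a smaller smallest bridge.

  Suppose \<open>\<sigma>\<close> is in \<open>V\<^sub>L\<close> but not in \<open>V\<^sub>B\<close>, and let \<open>m = m\<^sub>L(\<sigma>)\<close>.  As \<open>\<sigma>\<close> is not a target,
  \<open>s = sb(\<sigma>)\<close> exists and \<open>s \<le> m\<close> (\<open>sb_le_m_L\<close>): otherwise \<open>m\<close> would lie outside \<open>\<sigma>\<close> and
  be the smallest bridge of \<open>\<sigma> \<union> m\<close>, making \<open>\<sigma>\<close> a target.  Since no generator divides another, \<open>\<sigma>\<close> is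
  large enough to be a source, so it lost to a rival \<open>\<sigma>'\<close> with smallest bridge \<open>s' < s\<close> and
  \<open>\<sigma>' \<setminus> s' = \<sigma> \<setminus> s\<close>.  The rival is not a target either, which forces \<open>m\<^sub>L(\<sigma>') = m\<close>
  (\<open>m_L_exchange\<close>).  If \<open>s < m\<close>, then \<open>\<sigma>' \<union> m\<close> and \<open>\<sigma> \<union> m\<close> are a pair that the hypothesis
  forbids.  If \<open>s = m\<close>, then \<open>\<sigma>\<close> is \<open>\<sigma>' \<union> m\<close> without its smallest bridge \<open>s'\<close>, hence a target
  after all.

  The ranks count critical sets.  A basis of a free module over the polynomial ring has the expected
  number of elements because taking constant coefficients reduces the count to linear algebra over
  the field.
\<close>

section \<open>Divisibility of monomials as a closure operator\<close>

lemma mon_dvd_iff: "mon_dvd m n \<longleftrightarrow> (\<forall>x. Poly_Mapping.lookup m x \<le> Poly_Mapping.lookup n x)"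
proof
  assume "\<forall>x. Poly_Mapping.lookup m x \<le> Poly_Mapping.lookup n x"
  then have "n = m + (n - m)"
    by (intro poly_mapping_eqI) (simp add: lookup_add lookup_minus)
  then show "mon_dvd m n"
    unfolding mon_dvd_def by blast
qed (auto simp: mon_dvd_def lookup_add)

lemma mon_lcm_dvd_iff:
  assumes "finite \<sigma>"
  shows "mon_dvd (mon_lcm \<sigma>) n \<longleftrightarrow> (\<forall>m\<in>\<sigma>. mon_dvd m n)"
  using assms by (auto simp: mon_dvd_iff lookup_mon_lcm)

lemma mon_dvd_antisym: "mon_dvd m n \<Longrightarrow> mon_dvd n m \<Longrightarrow> m = n"
  by (auto simp: mon_dvd_iff intro!: poly_mapping_eqI order.antisym)

lemma mon_dvd_trans: "mon_dvd l m \<Longrightarrow> mon_dvd m n \<Longrightarrow> mon_dvd l n"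
  by (auto simp: mon_dvd_iff intro: order.trans)

text \<open>
  Apart from one bound on cardinalities, the arguments about bridges and \<open>m\<^sub>L\<close> use of divisibility
  only that this is a closure operator on finite sets.
\<close>

definition lcm_closure :: "'x::finite mon set \<Rightarrow> 'x mon set" where
  "lcm_closure \<sigma> = {m. mon_dvd m (mon_lcm \<sigma>)}"

lemma lcm_closure_extensive: "finite \<sigma> \<Longrightarrow> \<sigma> \<subseteq> lcm_closure \<sigma>"
  using mon_lcm_dvd_iff[of \<sigma> "mon_lcm \<sigma>"] by (auto simp: lcm_closure_def mon_dvd_iff)

lemma lcm_closure_minimal:
  assumes "finite \<sigma>" "\<sigma> \<subseteq> lcm_closure \<tau>"
  shows "lcm_closure \<sigma> \<subseteq> lcm_closure \<tau>"
  using assms mon_lcm_dvd_iff[of \<sigma> "mon_lcm \<tau>"] by (auto simp: lcm_closure_def intro: mon_dvd_trans)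

lemma lcm_closure_mono:
  assumes "finite \<tau>" "\<sigma> \<subseteq> \<tau>"
  shows "lcm_closure \<sigma> \<subseteq> lcm_closure \<tau>"
  using assms lcm_closure_extensive[of \<tau>]
  by (intro lcm_closure_minimal) (auto intro: finite_subset)

lemma lcm_closure_insert_absorb:
  assumes "finite \<sigma>" "m \<in> lcm_closure \<sigma>"
  shows "lcm_closure (insert m \<sigma>) = lcm_closure \<sigma>"
  using assms lcm_closure_extensive[of \<sigma>]
  by (intro equalityI lcm_closure_minimal lcm_closure_mono) auto

lemma in_bridges_iff:
  assumes "finite \<sigma>"
  shows "m \<in> bridges \<sigma> \<longleftrightarrow> m \<in> \<sigma> \<and> m \<in> lcm_closure (\<sigma> - {m})"
proof -
  have "mon_lcm (\<sigma> - {m}) = mon_lcm \<sigma>" if "m \<in> lcm_closure (\<sigma> - {m})"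
    using that assms lcm_closure_extensive[of "\<sigma> - {m}"] lcm_closure_extensive[of \<sigma>]
    by (intro mon_dvd_antisym) (auto simp: mon_lcm_dvd_iff lcm_closure_def)
  then show ?thesis
    using assms lcm_closure_extensive[of \<sigma>] by (auto simp: bridges_def lcm_closure_def)
qed

lemma bridges_subset: "bridges \<sigma> \<subseteq> \<sigma>"
  by (auto simp: bridges_def)

lemma bridges_mono:
  assumes "finite \<tau>" "\<sigma> \<subseteq> \<tau>"
  shows "bridges \<sigma> \<subseteq> bridges \<tau>"
proof
  fix b assume "b \<in> bridges \<sigma>"
  then show "b \<in> bridges \<tau>"
    using assms lcm_closure_mono[of "\<tau> - {b}" "\<sigma> - {b}"]
    by (auto simp: in_bridges_iff finite_subset)
qed

section \<open>Ordered generators\<close>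

locale ordered_generators =
  fixes G :: "'x::finite mon set" and gt :: "'x mon \<Rightarrow> 'x mon \<Rightarrow> bool"
  assumes finite_G: "finite G"
    and order: "strict_total_order_on G gt"
    and antichain: "m \<in> G \<Longrightarrow> n \<in> G \<Longrightarrow> mon_dvd m n \<Longrightarrow> m = n"
begin

lemma finite_generators: "\<sigma> \<subseteq> G \<Longrightarrow> finite \<sigma>"
  using finite_G by (rule finite_subset[rotated])

lemma gt_irrefl: "m \<in> G \<Longrightarrow> \<not> gt m m"
  using order by (auto simp: strict_total_order_on_def irreflp_on_def)

lemma gt_trans: "l \<in> G \<Longrightarrow> m \<in> G \<Longrightarrow> n \<in> G \<Longrightarrow> gt l m \<Longrightarrow> gt m n \<Longrightarrow> gt l n"
  using order unfolding strict_total_order_on_def transp_on_def by blast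

lemma gt_total: "m \<in> G \<Longrightarrow> n \<in> G \<Longrightarrow> m \<noteq> n \<Longrightarrow> gt m n \<or> gt n m"
  using order unfolding strict_total_order_on_def totalp_on_def by blast

lemma gt_asym: "m \<in> G \<Longrightarrow> n \<in> G \<Longrightarrow> gt m n \<Longrightarrow> \<not> gt n m"
  using gt_trans gt_irrefl by blast

lemma ex_smallest:
  assumes "S \<subseteq> G" "S \<noteq> {}"
  shows "\<exists>m\<in>S. \<forall>n\<in>S. n \<noteq> m \<longrightarrow> gt n m"
  using finite_generators[OF assms(1)] assms(2,1)
proof (induction S rule: finite_ne_induct)
  case (insert a S)
  then obtain m where m: "m \<in> S" "\<forall>n\<in>S. n \<noteq> m \<longrightarrow> gt n m"
    by auto
  have G: "a \<in> G" "m \<in> G" "S \<subseteq> G" "a \<noteq> m"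
    using insert m by auto
  show ?case
  proof (cases "gt a m")
    case True
    then show ?thesis using m by auto
  next
    case False
    then have "gt m a"
      using gt_total G by blast
    then have "\<forall>n\<in>S. gt n a"
      using m G gt_trans by (metis subsetD)
    then show ?thesis by auto
  qed
qed auto

lemma smallest_eq_iff:
  assumes "S \<subseteq> G" "S \<noteq> {}"
  shows "smallest gt S = m \<longleftrightarrow> m \<in> S \<and> (\<forall>n\<in>S. n \<noteq> m \<longrightarrow> gt n m)"
proof -
  have uniq: "m = m'"
    if "m \<in> S \<and> (\<forall>n\<in>S. n \<noteq> m \<longrightarrow> gt n m)" "m' \<in> S \<and> (\<forall>n\<in>S. n \<noteq> m' \<longrightarrow> gt n m')" for m m'
    using that assms gt_asym by (metis subsetD)
  obtain m0 where "m0 \<in> S \<and> (\<forall>n\<in>S. n \<noteq> m0 \<longrightarrow> gt n m0)"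
    using ex_smallest[OF assms] by blast
  moreover from this have "smallest gt S = m0"
    unfolding smallest_def by (rule the_equality) (use uniq calculation in blast)
  ultimately show ?thesis
    using uniq by blast
qed

lemma sb_eq_Some_iff:
  assumes "\<sigma> \<subseteq> G"
  shows "sb gt \<sigma> = Some s \<longleftrightarrow> s \<in> bridges \<sigma> \<and> (\<forall>t\<in>bridges \<sigma>. t \<noteq> s \<longrightarrow> gt t s)"
proof -
  have "bridges \<sigma> \<subseteq> G"
    using assms bridges_subset by auto
  then show ?thesis
    using smallest_eq_iff[of "bridges \<sigma>" s] by (auto simp: sb_def)
qed

lemma remove_sb_eq: "sb gt \<sigma> = Some s \<Longrightarrow> remove_sb gt \<sigma> = \<sigma> - {s}"
  by (simp add: remove_sb_def)

section \<open>The element \<open>m\<^sub>L(\<sigma>)\<close> without lists\<close>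

lemma sorted_wrt_unique:
  assumes "sorted_wrt gt l" "sorted_wrt gt l'" "set l = set l'" "set l \<subseteq> G"
  shows "l = l'"
  using assms
proof (induction l arbitrary: l')
  case (Cons a l)
  then obtain b k where l': "l' = b # k"
    by (cases l') auto
  have G: "a \<in> G" "b \<in> G"
    using Cons.prems l' by auto
  have "a = b"
  proof (rule ccontr)
    assume "a \<noteq> b"
    moreover have "a \<in> set (b # k)" "b \<in> set (a # l)"
      using Cons.prems l' by auto
    ultimately have "gt a b" "gt b a"
      using Cons.prems l' by auto
    then show False using gt_asym G by blast
  qed
  moreover have "a \<notin> set l" "b \<notin> set k"
    using Cons.prems l' G gt_irrefl by auto
  then have "set l = set k"
    using Cons.prems(3) l' \<open>a = b\<close> by (simp add: insert_ident)
  ultimately show ?case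
    using Cons.IH[of k] Cons.prems l' by auto
qed auto

lemma ex_sorted_wrt:
  assumes "\<sigma> \<subseteq> G"
  shows "\<exists>l. sorted_wrt gt l \<and> set l = \<sigma>"
  using finite_generators[OF assms] assms
proof (induction \<sigma> rule: finite_psubset_induct)
  case (psubset \<sigma>)
  show ?case
  proof (cases "\<sigma> = {}")
    case False
    then obtain s where s: "s \<in> \<sigma>" "\<forall>n\<in>\<sigma>. n \<noteq> s \<longrightarrow> gt n s"
      using ex_smallest psubset.prems by blast
    then obtain l where "sorted_wrt gt l \<and> set l = \<sigma> - {s}"
      using psubset.IH[of "\<sigma> - {s}"] psubset.prems by auto
    then have "sorted_wrt gt (l @ [s]) \<and> set (l @ [s]) = \<sigma>"
      using s by (auto simp: sorted_wrt_append)
    then show ?thesis by blast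
  qed auto
qed

lemma decreasing_list:
  assumes "\<sigma> \<subseteq> G"
  shows "sorted_wrt gt (decreasing_list gt \<sigma>)" "set (decreasing_list gt \<sigma>) = \<sigma>"
proof -
  obtain l where l: "sorted_wrt gt l \<and> set l = \<sigma>"
    using ex_sorted_wrt[OF assms] by blast
  have "decreasing_list gt \<sigma> = l"
    unfolding decreasing_list_def
    by (rule the_equality) (use l assms sorted_wrt_unique in auto)
  then show "sorted_wrt gt (decreasing_list gt \<sigma>)" "set (decreasing_list gt \<sigma>) = \<sigma>"
    using l by auto
qed

text \<open>The index \<open>k\<close> counts from \<open>1\<close>, as it does in \<open>v\<^sub>L\<close>.\<close>

lemma set_take_sorted_wrt:
  assumes "sorted_wrt gt l" "set l \<subseteq> G" "k \<in> {1..length l}"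
  shows "set (take k l) = {b \<in> set l. b = l ! (k - 1) \<or> gt b (l ! (k - 1))}"
proof (intro equalityI subsetI)
  fix b assume "b \<in> set (take k l)"
  then obtain i where i: "i < k" "b = l ! i"
    using assms(3) by (auto simp: in_set_conv_nth)
  have "b = l ! (k - 1) \<or> gt b (l ! (k - 1))"
  proof (cases "i = k - 1")
    case False
    then show ?thesis
      using i assms sorted_wrt_nth_less[of gt l i "k - 1"] by auto
  qed (use i in auto)
  then show "b \<in> {b \<in> set l. b = l ! (k - 1) \<or> gt b (l ! (k - 1))}"
    using i assms(3) by auto
next
  fix b assume b: "b \<in> {b \<in> set l. b = l ! (k - 1) \<or> gt b (l ! (k - 1))}"
  then obtain i where i: "i < length l" "b = l ! i"
    by (auto simp: in_set_conv_nth)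
  have "i < k"
  proof (rule ccontr)
    assume "\<not> i < k"
    then have gt: "gt (l ! (k - 1)) b"
      using assms i sorted_wrt_nth_less[of gt l "k - 1" i] by auto
    have "l ! (k - 1) \<in> G" "b \<in> G"
      using assms(2,3) b nth_mem[of "k - 1" l] by auto
    then show False
      using gt b gt_asym gt_irrefl by blast
  qed
  then show "b \<in> set (take k l)"
    using i by (auto simp: in_set_conv_nth)
qed

definition above :: "'x mon set \<Rightarrow> 'x mon \<Rightarrow> 'x mon set" where
  "above \<sigma> m = {b \<in> \<sigma>. gt b m}"

text \<open>Nonemptiness excludes the generator \<open>1\<close>, which divides even the empty lcm.\<close>

definition lyubeznik_candidates :: "'x mon set \<Rightarrow> 'x mon set" where
  "lyubeznik_candidates \<sigma> = {m \<in> G. above \<sigma> m \<noteq> {} \<and> m \<in> lcm_closure (above \<sigma> m)}"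

lemma above_subset: "above \<sigma> m \<subseteq> \<sigma>"
  by (auto simp: above_def)

lemma finite_above: "\<sigma> \<subseteq> G \<Longrightarrow> finite (above \<sigma> m)"
  using finite_subset[OF above_subset finite_generators] .

lemma above_subset_prefix:
  assumes "\<sigma> \<subseteq> G" "m \<in> G" "a \<in> \<sigma>" "gt a m"
  shows "{b \<in> \<sigma>. b = a \<or> gt b a} \<subseteq> above \<sigma> m"
  using assms gt_trans unfolding above_def by blast

text \<open>
  The largest admissible index cuts the decreasing list at the smallest element above \<open>m\<^sub>L(\<sigma>)\<close>, and
  every candidate \<open>m\<close> makes the index of the smallest element above \<open>m\<close> admissible.  Hence the index
  can be forgotten: \<open>m\<^sub>L(\<sigma>)\<close> is the smallest generator dividing the lcm of the elements of \<open>\<sigma>\<close>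
  above it.
\<close>

lemma m_L_eq_Some_iff:
  assumes "\<sigma> \<subseteq> G"
  shows "m_L G gt \<sigma> = Some m \<longleftrightarrow>
    m \<in> lyubeznik_candidates \<sigma> \<and> (\<forall>n\<in>lyubeznik_candidates \<sigma>. n \<noteq> m \<longrightarrow> gt n m)"
proof -
  define l where "l = decreasing_list gt \<sigma>"
  define K where "K = {k \<in> {1..length l}. \<exists>m\<in>G. gt (l ! (k - 1)) m \<and> m \<in> lcm_closure (set (take k l))}"
  define D where "D v = {m \<in> G. m \<in> lcm_closure (set (take v l))}" for v
  have l: "sorted_wrt gt l" "set l = \<sigma>"
    using decreasing_list[OF assms] by (auto simp: l_def)
  have prefix: "set (take k l) = {b \<in> \<sigma>. b = l ! (k - 1) \<or> gt b (l ! (k - 1))}"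
    if "k \<in> {1..length l}" for k
    using set_take_sorted_wrt[OF l(1)] that assms l(2) by auto
  have nth: "l ! (k - 1) \<in> \<sigma>" if "k \<in> {1..length l}" for k
    using that l(2) nth_mem[of "k - 1" l] by auto
  have mL: "m_L G gt \<sigma> = (if K = {} then None else Some (smallest gt (D (Max K))))"
    by (simp add: m_L_def v_L_def l_def K_def D_def lcm_closure_def Let_def)
  have finite_K: "finite K"
    by (simp add: K_def)
  \<comment> \<open>An admissible index yields candidates.\<close>
  have K_candidate: "n \<in> lyubeznik_candidates \<sigma>"
    if "k \<in> {1..length l}" "n \<in> G" "gt (l ! (k - 1)) n" "n \<in> lcm_closure (set (take k l))" for k n
  proof -
    have "set (take k l) \<subseteq> above \<sigma> n"
      using above_subset_prefix[OF assms that(2) nth[OF that(1)] that(3)] prefix[OF that(1)] by simp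
    moreover have "finite (above \<sigma> n)"
      using assms by (rule finite_above)
    ultimately have "n \<in> lcm_closure (above \<sigma> n)"
      using lcm_closure_mono that(4) by blast
    moreover have "above \<sigma> n \<noteq> {}"
      using nth[OF that(1)] that(3) by (auto simp: above_def)
    ultimately show ?thesis
      using that(2) by (simp add: lyubeznik_candidates_def)
  qed
  \<comment> \<open>Conversely the elements above a candidate form the prefix of an admissible index.\<close>
  have candidate_K: "\<exists>k\<in>K. gt (l ! (k - 1)) n \<and> set (take k l) = above \<sigma> n"
    if n: "n \<in> lyubeznik_candidates \<sigma>" for n
  proof -
    have "above \<sigma> n \<subseteq> G" "above \<sigma> n \<noteq> {}" "n \<in> G"
      using n assms by (auto simp: lyubeznik_candidates_def above_def)
    then obtain a where a: "a \<in> above \<sigma> n" "\<forall>b\<in>above \<sigma> n. b \<noteq> a \<longrightarrow> gt b a"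
      using ex_smallest by blast
    then have "a \<in> \<sigma>" "gt a n"
      by (auto simp: above_def)
    then obtain i where i: "i < length l" "l ! i = a"
      using l(2) by (auto simp: in_set_conv_nth)
    then have "set (take (Suc i) l) = above \<sigma> n"
      using prefix[of "Suc i"] a(2) above_subset_prefix[OF assms \<open>n \<in> G\<close> \<open>a \<in> \<sigma>\<close> \<open>gt a n\<close>]
      by (auto simp: above_def)
    then show ?thesis
      using i n \<open>gt a n\<close> by (intro bexI[of _ "Suc i"]) (auto simp: K_def lyubeznik_candidates_def)
  qed
  show ?thesis
  proof (cases "K = {}")
    case True
    then show ?thesis
      using mL candidate_K by auto
  next
    case False
    define v where "v = Max K"
    have v: "v \<in> K" "\<And>k. k \<in> K \<Longrightarrow> k \<le> v"
      using False finite_K by (auto simp: v_def)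
    then have v_range: "v \<in> {1..length l}"
      by (simp add: K_def)
    have D_G: "D v \<subseteq> G" and D_ne: "D v \<noteq> {}"
      using v(1) by (auto simp: D_def K_def)
    obtain m0 where m0: "smallest gt (D v) = m0" "m0 \<in> D v" "\<forall>n\<in>D v. n \<noteq> m0 \<longrightarrow> gt n m0"
      using smallest_eq_iff[OF D_G D_ne] by metis
    have m0_G: "m0 \<in> G"
      using m0 D_G by auto
    have pivot_G: "l ! (v - 1) \<in> G"
      using nth[OF v_range] assms by auto
    have "gt (l ! (v - 1)) m0"
    proof -
      obtain n where "n \<in> D v" "gt (l ! (v - 1)) n"
        using v(1) by (auto simp: K_def D_def)
      then show ?thesis
        using m0 m0_G D_G pivot_G gt_trans by (metis subsetD)
    qed
    then have "m0 \<in> lyubeznik_candidates \<sigma>"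
      using K_candidate[OF v_range m0_G] m0(2) by (simp add: D_def)
    moreover have "gt n m0" if n: "n \<in> lyubeznik_candidates \<sigma>" "n \<noteq> m0" for n
    proof -
      obtain k where k: "k \<in> K" "set (take k l) = above \<sigma> n"
        using candidate_K[OF n(1)] by blast
      have "set (take k l) \<subseteq> set (take v l)"
        using v(2)[OF k(1)] by (rule set_take_subset_set_take)
      then have "n \<in> lcm_closure (set (take v l))"
        using n k(2) lcm_closure_mono[of "set (take v l)" "above \<sigma> n"]
        by (auto simp: lyubeznik_candidates_def)
      then show ?thesis
        using m0 n by (auto simp: D_def lyubeznik_candidates_def)
    qed
    moreover have "lyubeznik_candidates \<sigma> \<subseteq> G"
      by (auto simp: lyubeznik_candidates_def)
    ultimately show ?thesis
      using mL False m0 gt_asym v_def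
      by (metis option.inject subsetD)
  qed
qed

lemma above_eqI: "\<sigma> - S = \<tau> - T \<Longrightarrow> (\<And>b. b \<in> S \<union> T \<Longrightarrow> \<not> gt b m) \<Longrightarrow> above \<sigma> m = above \<tau> m"
  unfolding above_def by blast

text \<open>Shrinking \<open>\<sigma>\<close> above \<open>n\<close> is the only way to lose a candidate \<open>n\<close>.\<close>

lemma lyubeznik_candidatesI:
  assumes "n \<in> lyubeznik_candidates \<sigma>" "above \<sigma> n \<subseteq> above \<tau> n" "\<tau> \<subseteq> G"
  shows "n \<in> lyubeznik_candidates \<tau>"
proof -
  have "finite (above \<tau> n)"
    using assms(3) by (rule finite_above)
  then show ?thesis
    using assms lcm_closure_mono[of "above \<tau> n" "above \<sigma> n"]
    unfolding lyubeznik_candidates_def by blast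
qed

lemma m_L_in_G: "\<sigma> \<subseteq> G \<Longrightarrow> m_L G gt \<sigma> = Some m \<Longrightarrow> m \<in> G"
  by (simp add: m_L_eq_Some_iff lyubeznik_candidates_def)

lemma m_L_in_closure:
  assumes "\<sigma> \<subseteq> G" "m_L G gt \<sigma> = Some m" "above \<sigma> m \<subseteq> \<tau>" "\<tau> \<subseteq> G"
  shows "m \<in> lcm_closure \<tau>"
  using assms lcm_closure_mono[OF finite_generators[OF assms(4)] assms(3)]
  by (auto simp: m_L_eq_Some_iff lyubeznik_candidates_def)

text \<open>
  Whether \<open>n\<close> is a candidate is decided above \<open>n\<close>, where \<open>m\<^sub>L(\<sigma>)\<close> contributes nothing to the
  lcm, as it divides the lcm of what lies above it already.
\<close>

lemma m_L_insert:
  assumes "\<sigma> \<subseteq> G" "m_L G gt \<sigma> = Some m"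
  shows "m_L G gt (insert m \<sigma>) = Some m"
proof -
  have m: "m \<in> G" "m \<in> lyubeznik_candidates \<sigma>"
    "\<And>n. n \<in> lyubeznik_candidates \<sigma> \<Longrightarrow> n \<noteq> m \<Longrightarrow> gt n m"
    using assms by (auto simp: m_L_eq_Some_iff lyubeznik_candidates_def)
  have G: "insert m \<sigma> \<subseteq> G"
    using m(1) assms(1) by simp
  have "above \<sigma> m \<subseteq> above (insert m \<sigma>) m"
    by (auto simp: above_def)
  then have "m \<in> lyubeznik_candidates (insert m \<sigma>)"
    using m(2) G lyubeznik_candidatesI by blast
  moreover have "gt n m" if n: "n \<in> lyubeznik_candidates (insert m \<sigma>)" "n \<noteq> m" for n
  proof (rule ccontr)
    assume "\<not> gt n m"
    have n_G: "n \<in> G"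
      using n by (simp add: lyubeznik_candidates_def)
    then have "gt m n"
      using \<open>\<not> gt n m\<close> n(2) m(1) gt_total by blast
    then have above_insert: "above (insert m \<sigma>) n = insert m (above \<sigma> n)"
      by (auto simp: above_def)
    have "above \<sigma> m \<subseteq> above \<sigma> n"
      using assms(1) m(1) n_G \<open>gt m n\<close> gt_trans unfolding above_def by blast
    moreover have "above \<sigma> n \<subseteq> G"
      using assms(1) above_subset by blast
    ultimately have "m \<in> lcm_closure (above \<sigma> n)"
      using m_L_in_closure[OF assms] by blast
    then have "lcm_closure (above (insert m \<sigma>) n) = lcm_closure (above \<sigma> n)"
      using above_insert \<open>above \<sigma> n \<subseteq> G\<close> lcm_closure_insert_absorb[of "above \<sigma> n" m] finite_generators
      by simp
    moreover have "above \<sigma> n \<noteq> {}"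
      using \<open>above \<sigma> m \<subseteq> above \<sigma> n\<close> m(2) by (auto simp: lyubeznik_candidates_def)
    ultimately have "n \<in> lyubeznik_candidates \<sigma>"
      using n by (simp add: lyubeznik_candidates_def)
    then show False
      using m(3) n(2) \<open>\<not> gt n m\<close> by blast
  qed
  ultimately show ?thesis
    using G by (simp add: m_L_eq_Some_iff)
qed

lemma m_L_remove:
  assumes "\<sigma> \<subseteq> G" "m_L G gt \<sigma> = Some m"
  shows "m_L G gt (\<sigma> - {m}) = Some m"
proof -
  have m: "m \<in> G" "m \<in> lyubeznik_candidates \<sigma>"
    "\<And>n. n \<in> lyubeznik_candidates \<sigma> \<Longrightarrow> n \<noteq> m \<Longrightarrow> gt n m"
    using assms by (auto simp: m_L_eq_Some_iff lyubeznik_candidates_def)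
  have "above (\<sigma> - {m}) m = above \<sigma> m"
    using gt_irrefl[OF m(1)] by (auto simp: above_def)
  then have "m \<in> lyubeznik_candidates (\<sigma> - {m})"
    using m(2) by (simp add: lyubeznik_candidates_def)
  moreover have "n \<in> lyubeznik_candidates \<sigma>" if "n \<in> lyubeznik_candidates (\<sigma> - {m})" for n
    by (rule lyubeznik_candidatesI[OF that _ assms(1)]) (auto simp: above_def)
  ultimately show ?thesis
    using assms(1) m(3) by (subst m_L_eq_Some_iff) auto
qed

lemma lyubeznik_matchingD:
  assumes "\<sigma> \<in> Field (lyubeznik_matching G gt)"
  shows "\<sigma> \<subseteq> G \<and> (\<exists>m. m_L G gt \<sigma> = Some m)"
  using assms m_L_insert m_L_remove m_L_in_G
  by (fastforce simp: Field_def lyubeznik_matching_def)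

text \<open>If a single element lay above \<open>m\<^sub>L(\<sigma>)\<close>, it would be a multiple of this other generator.\<close>

lemma two_le_card_above:
  assumes "\<sigma> \<subseteq> G" "m_L G gt \<sigma> = Some m"
  shows "2 \<le> card (above \<sigma> m)"
proof (rule ccontr)
  assume "\<not> 2 \<le> card (above \<sigma> m)"
  have m: "m \<in> G" "above \<sigma> m \<noteq> {}" "m \<in> lcm_closure (above \<sigma> m)"
    using assms by (auto simp: m_L_eq_Some_iff lyubeznik_candidates_def)
  moreover have "finite (above \<sigma> m)"
    using assms(1) by (rule finite_above)
  ultimately have "card (above \<sigma> m) = 1"
    using \<open>\<not> 2 \<le> card (above \<sigma> m)\<close> by (metis One_nat_def Suc_1 card_0_eq less_2_cases not_le)
  then obtain a where a: "above \<sigma> m = {a}"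
    by (auto simp: card_1_singleton_iff)
  have "a \<in> G" "gt a m"
    using a assms(1) by (auto simp: above_def)
  have "mon_dvd (mon_lcm {a}) a"
    by (subst mon_lcm_dvd_iff) (simp_all add: mon_dvd_iff)
  then have "mon_dvd m a"
    using m(3) a mon_dvd_trans by (auto simp: lcm_closure_def)
  then have "m = a"
    using antichain m(1) \<open>a \<in> G\<close> by blast
  then show False
    using \<open>gt a m\<close> gt_irrefl m(1) by simp
qed

section \<open>The Barile--Macchia matching\<close>

text \<open>Equivalently, \<open>\<sigma>\<close> is \<open>\<rho> \<setminus> sb(\<rho>)\<close> for some \<open>\<rho> \<subseteq> G\<close> that has a bridge.\<close>

definition extends_by_sb :: "'x mon set \<Rightarrow> bool" where
  "extends_by_sb \<sigma> \<longleftrightarrow> (\<exists>m\<in>G - \<sigma>. sb gt (insert m \<sigma>) = Some m)"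

text \<open>
  At the end, when \<open>\<Omega>\<close> is empty, the second, third and fourth part say that the sources are exactly
  the sets with at least three elements and a bridge that are not targets.  The fifth part keeps a
  target from becoming a source later, and the sixth, which expresses that sets are processed by
  decreasing cardinality, keeps it from having been a source before.
\<close>

lemma bm_reaches_invariant:
  assumes "bm_reaches G gt \<Omega> A"
  shows "\<Omega> \<subseteq> {\<sigma>. \<sigma> \<subseteq> G \<and> 3 \<le> card \<sigma>}"
    and "A \<subseteq> {(\<sigma>, remove_sb gt \<sigma>) | \<sigma>. \<sigma> \<subseteq> G \<and> 3 \<le> card \<sigma> \<and> sb gt \<sigma> \<noteq> None}"
    and "\<And>\<sigma>. \<sigma> \<subseteq> G \<Longrightarrow> 3 \<le> card \<sigma> \<Longrightarrow> \<sigma> \<notin> \<Omega> \<Longrightarrow> sb gt \<sigma> \<noteq> None \<Longrightarrow> \<sigma> \<notin> Range A \<Longrightarrow> \<sigma> \<in> Domain A"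
    and "Domain A \<inter> Range A = {}"
    and "\<Omega> \<inter> Range A = {}"
    and "\<And>\<sigma> \<tau>. \<sigma> \<in> Domain A \<Longrightarrow> \<tau> \<in> \<Omega> \<Longrightarrow> card \<tau> \<le> card \<sigma>"
  using assms
proof (induction \<Omega> A rule: bm_reaches.induct)
  case start
  { case 1 show ?case by auto next
    case 2 show ?case by auto next
    case 3 then show ?case by auto next
    case 4 show ?case by auto next
    case 5 show ?case by auto next
    case 6 then show ?case by auto }
next
  case (step \<Omega> A \<sigma>)
  let ?A = "if sb gt \<sigma> = None then A else insert (\<sigma>, remove_sb gt \<sigma>) A"
  have \<sigma>: "\<sigma> \<subseteq> G" "3 \<le> card \<sigma>"
    using step.IH(1) step.hyps(2) by auto
  have card_less: "card (remove_sb gt \<sigma>) < card \<sigma>" if "sb gt \<sigma> \<noteq> None"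
  proof -
    from that obtain s where s: "sb gt \<sigma> = Some s"
      by auto
    then have "s \<in> \<sigma>"
      using sb_eq_Some_iff \<sigma>(1) bridges_subset by blast
    then show ?thesis
      using s card_Diff1_less[OF finite_generators[OF \<sigma>(1)]] by (simp add: remove_sb_eq del: card_Diff_singleton)
  qed
  { case 1 show ?case using step.IH(1) by auto next
    case 2 show ?case using step.IH(2) \<sigma> by auto next
    case (3 \<rho>)
    show ?case
    proof (cases "\<rho> \<in> \<Omega>")
      case True
      then show ?thesis
        using 3 by (auto simp: remove_sb_def split: if_splits)
    next
      case False
      then show ?thesis
        using 3 step.IH(3)[of \<rho>] by (auto split: if_splits)
    qed
  next
    case 4
    \<comment> \<open>All earlier sources are at least as large as \<open>\<sigma>\<close>, hence larger than the new target.\<close>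
    have "remove_sb gt \<sigma> \<notin> Domain A" if "sb gt \<sigma> \<noteq> None"
      using step.IH(6)[OF _ step.hyps(2)] card_less[OF that] by fastforce
    moreover have "remove_sb gt \<sigma> \<noteq> \<sigma>" if "sb gt \<sigma> \<noteq> None"
      using card_less[OF that] by auto
    ultimately show ?case
      using step.IH(4,5) step.hyps(2) by (auto split: if_splits)
  next
    case 5 show ?case using step.IH(5) by (auto split: if_splits)
  next
    case (6 \<rho> \<tau>)
    then show ?case
      using step.IH(6) step.hyps(3) by (auto split: if_splits)
  }
qed

text \<open>
  Here \<open>A\<close> is the set of edges before pruning.  Among the \<open>m\<close> that witness the hypothesis the smallest
  one gives a set \<open>\<sigma> \<union> m\<close> which is not itself a target: if it came from \<open>\<sigma> \<union> {m, n}\<close>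
  with smallest bridge \<open>n\<close>, then \<open>n\<close> would be a smaller witness.
\<close>

lemma extends_by_sb_in_Range:
  assumes "bm_reaches G gt {} A" "\<sigma> \<subseteq> G" "2 \<le> card \<sigma>" "extends_by_sb \<sigma>"
  shows "\<sigma> \<in> Range A"
proof -
  note A = bm_reaches_invariant[OF assms(1)]
  define W where "W = {m \<in> G - \<sigma>. sb gt (insert m \<sigma>) = Some m}"
  have "W \<subseteq> G" "W \<noteq> {}"
    using assms(4) by (auto simp: W_def extends_by_sb_def)
  then obtain m where m: "m \<in> W" "\<forall>n\<in>W. n \<noteq> m \<longrightarrow> gt n m"
    using ex_smallest by blast
  have m_\<sigma>: "m \<in> G" "m \<notin> \<sigma>" "sb gt (insert m \<sigma>) = Some m"
    using m(1) by (auto simp: W_def)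
  have fin: "finite \<sigma>"
    using assms(2) finite_generators by blast
  have G: "insert m \<sigma> \<subseteq> G"
    using m_\<sigma> assms(2) by simp
  have m_closure: "m \<in> lcm_closure \<sigma>"
    using m_\<sigma> G fin sb_eq_Some_iff[OF G] by (simp add: in_bridges_iff)
  have "insert m \<sigma> \<notin> Range A"
  proof
    assume "insert m \<sigma> \<in> Range A"
    then obtain \<rho> n where \<rho>: "\<rho> \<subseteq> G" "sb gt \<rho> = Some n" "insert m \<sigma> = \<rho> - {n}"
      using A(2) by (auto simp: remove_sb_def)
    have n: "n \<in> bridges \<rho>" "\<And>b. b \<in> bridges \<rho> \<Longrightarrow> b \<noteq> n \<Longrightarrow> gt b n"
      using \<rho> sb_eq_Some_iff by auto
    have "n \<in> \<rho>" "n \<in> G"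
      using n(1) bridges_subset \<rho>(1) by blast+
    then have \<rho>_eq: "\<rho> = insert n (insert m \<sigma>)" "n \<noteq> m" "n \<notin> \<sigma>"
      using \<rho>(3) by auto
    have "n \<in> lcm_closure (insert m \<sigma>)"
      using n(1) \<rho> finite_generators by (simp add: in_bridges_iff)
    then have "n \<in> lcm_closure \<sigma>"
      using lcm_closure_insert_absorb[OF fin m_closure] by simp
    then have "n \<in> bridges (insert n \<sigma>)"
      using fin \<rho>_eq by (simp add: in_bridges_iff)
    moreover have "bridges (insert n \<sigma>) \<subseteq> bridges \<rho>"
      using \<rho>_eq \<rho>(1) finite_generators by (intro bridges_mono) auto
    moreover have "insert n \<sigma> \<subseteq> G"
      using \<open>n \<in> G\<close> assms(2) by simp
    ultimately have "sb gt (insert n \<sigma>) = Some n"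
      using n(2) by (auto simp: sb_eq_Some_iff)
    then have "gt n m"
      using m(2) \<open>n \<in> G\<close> \<rho>_eq by (simp add: W_def)
    moreover have "m \<in> bridges \<rho>"
      using bridges_mono[of \<rho> "insert m \<sigma>"] m_\<sigma>(3) sb_eq_Some_iff[OF G] \<rho>_eq \<rho>(1) finite_generators
      by blast
    then have "gt m n"
      using n(2) \<rho>_eq by blast
    ultimately show False
      using gt_asym m_\<sigma>(1) \<open>n \<in> G\<close> by blast
  qed
  moreover have "3 \<le> card (insert m \<sigma>)"
    using assms(3) m_\<sigma> fin by simp
  ultimately have "insert m \<sigma> \<in> Domain A"
    using A(3)[of "insert m \<sigma>"] G m_\<sigma> by simp
  then obtain \<tau> where "(insert m \<sigma>, \<tau>) \<in> A"
    by blast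
  then have "(insert m \<sigma>, remove_sb gt (insert m \<sigma>)) \<in> A"
    using A(2) by auto
  then show ?thesis
    using remove_sb_eq[OF m_\<sigma>(3)] m_\<sigma>(2) by auto
qed

text \<open>Among the edges with a given target the one with the smallest bridge survives.\<close>

lemma Range_bm_prune:
  assumes "bm_reaches G gt {} A" "\<tau> \<in> Range A"
  shows "\<tau> \<in> Range (bm_prune gt A)"
proof -
  note A = bm_reaches_invariant(2)[OF assms(1)]
  define S where "S = {s. \<exists>\<sigma>. (\<sigma>, \<tau>) \<in> A \<and> sb gt \<sigma> = Some s}"
  have "S \<subseteq> G"
    using A bridges_subset by (fastforce simp: S_def sb_eq_Some_iff)
  moreover have "S \<noteq> {}"
    using assms(2) A by (fastforce simp: S_def)
  ultimately obtain s where s: "s \<in> S" "\<forall>n\<in>S. n \<noteq> s \<longrightarrow> gt n s"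
    using ex_smallest by blast
  then obtain \<sigma> where \<sigma>: "(\<sigma>, \<tau>) \<in> A" "sb gt \<sigma> = Some s"
    by (auto simp: S_def)
  have "\<not> gt s (the (sb gt \<sigma>'))" if \<sigma>': "(\<sigma>', \<tau>) \<in> A" for \<sigma>'
  proof -
    obtain n where "sb gt \<sigma>' = Some n"
      using A \<sigma>' by auto
    moreover from this have "n \<in> S"
      using \<sigma>' by (auto simp: S_def)
    ultimately show ?thesis
      using s \<open>S \<subseteq> G\<close> gt_asym gt_irrefl by (metis option.sel subsetD)
  qed
  then have "(\<sigma>, \<tau>) \<in> bm_prune gt A"
    using \<sigma> by (auto simp: bm_prune_def)
  then show ?thesis by blast
qed

text \<open>
  The only way for such a set to be unmatched is to be a source that pruning removed in favour of
  a source \<open>\<sigma>'\<close>.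
\<close>

lemma bm_unmatchedD:
  assumes "barile_macchia_matching G gt B" "\<sigma> \<subseteq> G" "\<sigma> \<notin> Field B" "3 \<le> card \<sigma>" "sb gt \<sigma> = Some s"
  obtains \<sigma>' s' where "\<sigma>' \<subseteq> G" "sb gt \<sigma>' = Some s'" "\<sigma>' - {s'} = \<sigma> - {s}" "gt s s'"
    "\<not> extends_by_sb \<sigma>'"
proof -
  obtain A where A: "bm_reaches G gt {} A" "B = bm_prune gt A"
    using assms(1) by (auto simp: barile_macchia_matching_def)
  note inv = bm_reaches_invariant[OF A(1)]
  have "\<sigma> \<notin> Range A"
    using Range_bm_prune[OF A(1)] A(2) assms(3) by (auto simp: Field_def)
  then have "\<sigma> \<in> Domain A"
    using inv(3) assms by auto
  then have edge: "(\<sigma>, remove_sb gt \<sigma>) \<in> A"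
    using inv(2) by auto
  moreover have "(\<sigma>, remove_sb gt \<sigma>) \<notin> bm_prune gt A"
    using assms(3) A(2) by (auto simp: Field_def)
  ultimately obtain \<sigma>' where \<sigma>': "(\<sigma>', remove_sb gt \<sigma>) \<in> A" "gt s (the (sb gt \<sigma>'))"
    using assms(5) by (auto simp: bm_prune_def)
  then obtain s' where s': "\<sigma>' \<subseteq> G" "3 \<le> card \<sigma>'" "sb gt \<sigma>' = Some s'" "remove_sb gt \<sigma>' = remove_sb gt \<sigma>"
    using inv(2) by auto
  have "\<sigma>' \<notin> Range A"
    using \<sigma>'(1) inv(4) by blast
  then have "\<not> extends_by_sb \<sigma>'"
    using extends_by_sb_in_Range[OF A(1)] s' by auto
  then show thesis
    using that[OF s'(1,3)] s' \<sigma>'(2) assms(5) by (simp add: remove_sb_eq)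
qed

lemma bm_unmatched_not_extends:
  assumes "barile_macchia_matching G gt B" "\<sigma> \<subseteq> G" "\<sigma> \<notin> Field B" "2 \<le> card \<sigma>"
  shows "\<not> extends_by_sb \<sigma>"
  using assms extends_by_sb_in_Range Range_bm_prune
  unfolding barile_macchia_matching_def Field_def by blast

section \<open>Comparison of the two matchings\<close>

text \<open>
  For \<open>t\<close> below \<open>m = m\<^sub>L(\<sigma>)\<close>, the lcm of \<open>\<sigma> \<setminus> t\<close> is already a multiple of \<open>m\<close>, so that
  \<open>m\<close> does not help \<open>t\<close> to be a bridge.
\<close>

lemma bridges_insert_m_L:
  assumes "\<sigma> \<subseteq> G" "m_L G gt \<sigma> = Some m" "t \<in> bridges (insert m \<sigma>)" "gt m t"
  shows "t \<in> bridges \<sigma>"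
proof -
  have m: "m \<in> G"
    using assms m_L_in_G by blast
  have fin: "finite \<sigma>"
    using assms(1) finite_generators by blast
  have t: "t \<in> insert m \<sigma>" "t \<noteq> m" "t \<in> lcm_closure (insert m \<sigma> - {t})"
    using assms(3,4) fin gt_irrefl[OF m] by (auto simp: in_bridges_iff)
  then have "t \<in> \<sigma>" "t \<in> G"
    using assms(1) by auto
  then have "above \<sigma> m \<subseteq> \<sigma> - {t}"
    using gt_asym m assms(4) by (auto simp: above_def)
  then have "m \<in> lcm_closure (\<sigma> - {t})"
    using m_L_in_closure[OF assms(1,2)] assms(1) by blast
  moreover have "insert m \<sigma> - {t} = insert m (\<sigma> - {t})"
    using t(2) by auto
  ultimately show ?thesis
    using t fin \<open>t \<in> \<sigma>\<close> lcm_closure_insert_absorb[of "\<sigma> - {t}" m] by (simp add: in_bridges_iff)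
qed

lemma m_L_bridge:
  assumes "\<sigma> \<subseteq> G" "m_L G gt \<sigma> = Some m"
  shows "m \<in> bridges (insert m \<sigma>)"
proof -
  have "above \<sigma> m \<subseteq> \<sigma> - {m}"
    using gt_irrefl m_L_in_G[OF assms] by (auto simp: above_def)
  then have "m \<in> lcm_closure (\<sigma> - {m})"
    using assms(1) by (intro m_L_in_closure[OF assms]) auto
  then show ?thesis
    using assms(1) finite_generators by (simp add: in_bridges_iff)
qed

text \<open>
  If \<open>m = m\<^sub>L(\<sigma>)\<close> lies in \<open>\<sigma>\<close>, it is a bridge of \<open>\<sigma>\<close>.  Otherwise it is a bridge of \<open>\<sigma> \<union> m\<close>, not
  the smallest one by hypothesis, and the smaller ones are bridges of \<open>\<sigma>\<close>.
\<close>

lemma sb_le_m_L: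
  assumes "\<sigma> \<subseteq> G" "m_L G gt \<sigma> = Some m" "\<not> extends_by_sb \<sigma>"
  obtains s where "sb gt \<sigma> = Some s" "s = m \<or> gt m s"
proof -
  have G: "insert m \<sigma> \<subseteq> G"
    using assms m_L_in_G by simp
  have "\<exists>t\<in>bridges \<sigma>. t = m \<or> gt m t"
  proof (cases "m \<in> \<sigma>")
    case True
    then show ?thesis
      using m_L_bridge[OF assms(1,2)] by (auto simp: insert_absorb)
  next
    case False
    then have "sb gt (insert m \<sigma>) \<noteq> Some m"
      using assms(3) G by (auto simp: extends_by_sb_def)
    then obtain t where t: "t \<in> bridges (insert m \<sigma>)" "t \<noteq> m" "\<not> gt t m"
      using sb_eq_Some_iff[OF G, of m] m_L_bridge[OF assms(1,2)] by blast
    then have "gt m t"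
      using G bridges_subset[of "insert m \<sigma>"] gt_total[of m t] by auto
    then show ?thesis
      using bridges_insert_m_L[OF assms(1,2) t(1)] by blast
  qed
  then obtain t where t: "t \<in> bridges \<sigma>" "t = m \<or> gt m t"
    by blast
  then have "sb gt \<sigma> \<noteq> None"
    by (auto simp: sb_def)
  then obtain s where s: "sb gt \<sigma> = Some s"
    by blast
  have "s = t \<or> gt t s" "s \<in> \<sigma>" "t \<in> \<sigma>"
    using s t(1) sb_eq_Some_iff[OF assms(1), of s] bridges_subset[of \<sigma>] by auto
  then have "s = m \<or> gt m s"
    using t(2) G gt_trans[of m t s] by auto
  then show thesis
    using s that by blast
qed

lemma sb_insert_m_L:
  assumes "\<sigma> \<subseteq> G" "m_L G gt \<sigma> = Some m" "sb gt \<sigma> = Some s" "gt m s"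
  shows "sb gt (insert m \<sigma>) = Some s"
proof -
  have m: "m \<in> G" and G: "insert m \<sigma> \<subseteq> G"
    using assms m_L_in_G by auto
  have s: "s \<in> bridges \<sigma>" "\<And>t. t \<in> bridges \<sigma> \<Longrightarrow> t \<noteq> s \<Longrightarrow> gt t s"
    using assms sb_eq_Some_iff by auto
  have "s \<in> bridges (insert m \<sigma>)"
    using s(1) bridges_mono[of "insert m \<sigma>" \<sigma>] G finite_generators by blast
  moreover have "gt t s" if t: "t \<in> bridges (insert m \<sigma>)" "t \<noteq> s" for t
  proof (cases "gt m t")
    case True
    then show ?thesis
      using s(2) bridges_insert_m_L[OF assms(1,2) t(1)] t(2) by blast
  next
    case False
    have "t \<in> G" "s \<in> G"
      using t(1) s(1) G bridges_subset by blast+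
    then show ?thesis
      using False m assms(4) gt_total[of m t] gt_trans[of t m s] by auto
  qed
  ultimately show ?thesis
    using G sb_eq_Some_iff by blast
qed

text \<open>
  Above \<open>m\<close> the two sets agree, so \<open>m\<close> is a candidate for \<open>\<sigma>'\<close>.  The smallest candidate \<open>n\<close> for
  \<open>\<sigma>'\<close> cannot lie below \<open>s' = sb(\<sigma>')\<close>, as \<open>\<sigma>'\<close> does not extend by a smallest bridge; hence above \<open>n\<close>
  the set \<open>\<sigma>'\<close> lies in \<open>\<sigma>\<close>, and \<open>n\<close> is a candidate for \<open>\<sigma>\<close> too.
\<close>

lemma m_L_exchange:
  assumes "\<sigma> \<subseteq> G" "m_L G gt \<sigma> = Some m" "s = m \<or> gt m s" "s \<in> G"
    and "\<sigma>' \<subseteq> G" "\<sigma>' - {s'} = \<sigma> - {s}" "sb gt \<sigma>' = Some s'" "gt s s'" "\<not> extends_by_sb \<sigma>'"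
  shows "m_L G gt \<sigma>' = Some m"
proof -
  have m: "m \<in> G" "m \<in> lyubeznik_candidates \<sigma>"
    "\<And>n. n \<in> lyubeznik_candidates \<sigma> \<Longrightarrow> n \<noteq> m \<Longrightarrow> gt n m"
    using assms(1,2) by (auto simp: m_L_eq_Some_iff lyubeznik_candidates_def)
  have s': "s' \<in> G"
    using assms(5,7) sb_eq_Some_iff bridges_subset by blast
  have "\<not> gt s m" "\<not> gt s' m"
    using assms(3,4,8) m(1) s' gt_asym gt_irrefl gt_trans by metis+
  then have "above \<sigma> m = above \<sigma>' m"
    using assms(6)[symmetric] by (intro above_eqI[of _ "{s}" _ "{s'}"]) auto
  then have cand: "m \<in> lyubeznik_candidates \<sigma>'"
    using m(2) by (simp add: lyubeznik_candidates_def)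
  then have "m_L G gt \<sigma>' \<noteq> None"
  proof -
    have "lyubeznik_candidates \<sigma>' \<subseteq> G" "lyubeznik_candidates \<sigma>' \<noteq> {}"
      using cand by (auto simp: lyubeznik_candidates_def)
    then obtain n where "n \<in> lyubeznik_candidates \<sigma>'" "\<forall>k\<in>lyubeznik_candidates \<sigma>'. k \<noteq> n \<longrightarrow> gt k n"
      using ex_smallest by blast
    then have "m_L G gt \<sigma>' = Some n"
      using assms(5) by (simp add: m_L_eq_Some_iff)
    then show ?thesis by simp
  qed
  then obtain n where n: "m_L G gt \<sigma>' = Some n"
    by blast
  have n': "n \<in> G" "n \<in> lyubeznik_candidates \<sigma>'" "n = m \<or> gt m n"
    using n assms(5) cand by (auto simp: m_L_eq_Some_iff lyubeznik_candidates_def)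
  have "s' = n \<or> gt n s'"
    using sb_le_m_L[OF assms(5) n assms(9)] assms(7) by auto
  then have "\<not> gt s' n"
    using n'(1) s' gt_asym gt_irrefl by blast
  then have "above \<sigma>' n \<subseteq> above \<sigma> n"
    using assms(6) unfolding above_def by blast
  then have "n \<in> lyubeznik_candidates \<sigma>"
    using n'(2) assms(1) lyubeznik_candidatesI by blast
  then have "n = m"
    using m(3) n'(1,3) m(1) gt_asym by blast
  then show ?thesis
    using n by simp
qed

lemma Field_lyubeznik_subset_Field_barile_macchia:
  assumes B: "barile_macchia_matching G gt B"
    and no_pair: "\<And>\<sigma> \<tau> s t m. \<lbrakk>\<sigma> \<subseteq> G; \<tau> \<subseteq> G; sb gt \<sigma> = Some s; sb gt \<tau> = Some t;
      m_L G gt \<sigma> = Some m; m_L G gt \<tau> = Some m; \<sigma> - {s} = \<tau> - {t}; gt t s; gt m t; m \<in> \<tau>\<rbrakk>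
      \<Longrightarrow> False"
  shows "Field (lyubeznik_matching G gt) \<subseteq> Field B"
proof (rule subsetI, rule ccontr)
  fix \<sigma> assume "\<sigma> \<in> Field (lyubeznik_matching G gt)" and \<sigma>_B: "\<sigma> \<notin> Field B"
  then obtain m where \<sigma>: "\<sigma> \<subseteq> G" and m: "m_L G gt \<sigma> = Some m"
    using lyubeznik_matchingD by blast
  have m_G: "m \<in> G"
    using \<sigma> m m_L_in_G by blast
  have fin: "finite \<sigma>"
    using \<sigma> finite_generators by blast
  have "2 \<le> card \<sigma>"
    using two_le_card_above[OF \<sigma> m] card_mono[OF fin above_subset] by (rule order.trans)
  then have not_ext: "\<not> extends_by_sb \<sigma>"
    using bm_unmatched_not_extends[OF B \<sigma> \<sigma>_B] by blast
  obtain s where s: "sb gt \<sigma> = Some s" "s = m \<or> gt m s"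
    using sb_le_m_L[OF \<sigma> m not_ext] by blast
  have s_\<sigma>: "s \<in> \<sigma>" "s \<in> G"
    using s(1) \<sigma> sb_eq_Some_iff bridges_subset by blast+
  \<comment> \<open>Two elements above \<open>m\<close> and \<open>s \<le> m\<close> make \<open>\<sigma>\<close> large enough for the algorithm to pick it.\<close>
  have "s \<notin> above \<sigma> m"
    using s(2) s_\<sigma> m_G gt_irrefl gt_asym by (auto simp: above_def)
  then have "card (insert s (above \<sigma> m)) = Suc (card (above \<sigma> m))"
    using fin by (simp add: above_def)
  moreover have "card (insert s (above \<sigma> m)) \<le> card \<sigma>"
    using s_\<sigma>(1) above_subset fin by (intro card_mono) auto
  ultimately have "3 \<le> card \<sigma>"
    using two_le_card_above[OF \<sigma> m] by simp
  then obtain \<sigma>' s' where \<sigma>': "\<sigma>' \<subseteq> G" "sb gt \<sigma>' = Some s'" "\<sigma>' - {s'} = \<sigma> - {s}" "gt s s'"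
    "\<not> extends_by_sb \<sigma>'"
    using bm_unmatchedD[OF B \<sigma> \<sigma>_B _ s(1)] by blast
  have s'_\<sigma>': "s' \<in> \<sigma>'" "s' \<in> G"
    using \<sigma>'(1,2) sb_eq_Some_iff bridges_subset by blast+
  have m': "m_L G gt \<sigma>' = Some m"
    using m_L_exchange[OF \<sigma> m s(2) s_\<sigma>(2) \<sigma>'(1,3,2,4,5)] .
  have less: "gt m s'"
    using s(2) \<sigma>'(4) gt_trans m_G s_\<sigma>(2) s'_\<sigma>'(2) by blast
  have sb': "sb gt (insert m \<sigma>') = Some s'"
    using sb_insert_m_L[OF \<sigma>'(1) m' \<sigma>'(2) less] .
  have ne: "s \<noteq> s'" "m \<noteq> s'"
    using \<sigma>'(4) less gt_irrefl s_\<sigma>(2) m_G by auto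
  show False
  proof (cases "s = m")
    case True
    \<comment> \<open>Deleting \<open>s'\<close>, the smallest bridge of \<open>\<sigma>' \<union> m\<close>, gives \<open>\<sigma>\<close>.\<close>
    then have "insert m \<sigma>' = insert s' \<sigma>" "s' \<notin> \<sigma>"
      using \<sigma>'(3) s_\<sigma>(1) s'_\<sigma>'(1) ne by blast+
    then show False
      using not_ext sb' s'_\<sigma>'(2) by (auto simp: extends_by_sb_def)
  next
    case False
    then have "gt m s"
      using s(2) by blast
    then have "sb gt (insert m \<sigma>) = Some s"
      using sb_insert_m_L[OF \<sigma> m s(1)] by blast
    moreover have "insert m \<sigma>' - {s'} = insert m \<sigma> - {s}"
      using \<sigma>'(3) False ne by blast
    moreover have "m_L G gt (insert m \<sigma>) = Some m" "m_L G gt (insert m \<sigma>') = Some m"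
      using m_L_insert \<sigma> m \<sigma>'(1) m' by blast+
    moreover have "insert m \<sigma> \<subseteq> G" "insert m \<sigma>' \<subseteq> G" "m \<in> insert m \<sigma>"
      using \<sigma> \<sigma>'(1) m_G by auto
    ultimately show False
      using no_pair[of "insert m \<sigma>'" "insert m \<sigma>" s' s m] sb' \<sigma>'(4) \<open>gt m s\<close> by simp
  qed
qed

end

section \<open>Ranks of free modules\<close>

lemma sum_scaled_singles:
  fixes f :: "'b \<Rightarrow>\<^sub>0 'r::comm_ring_1"
  shows "f = (\<Sum>b\<in>Poly_Mapping.keys f. scale_free (Poly_Mapping.lookup f b) (Poly_Mapping.single b 1))"
  by (rule poly_mapping_eqI)
    (simp add: lookup_sum lookup_scale_free lookup_single when_def if_distrib sum.If_cases
      Int_absorb2 in_keys_iff cong: if_cong)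

lemma independent_singles:
  "free_module.independent ((\<lambda>b. Poly_Mapping.single b (1::'r::comm_ring_1)) ` X)"
proof -
  let ?e = "\<lambda>b. Poly_Mapping.single b (1::'r)"
  have "u v = 0"
    if "finite t" "t \<subseteq> ?e ` X" "(\<Sum>v\<in>t. scale_free (u v) v) = 0" "v \<in> t" for t u v
  proof -
    from that obtain b where b: "v = ?e b"
      by auto
    have "Poly_Mapping.lookup (scale_free (u w) w) b = (if w = v then u v else 0)" if "w \<in> t" for w
      using that \<open>t \<subseteq> ?e ` X\<close> b by (auto simp: lookup_scale_free lookup_single when_def)
    then have "Poly_Mapping.lookup (\<Sum>w\<in>t. scale_free (u w) w) b = (\<Sum>w\<in>t. if w = v then u v else 0)"
      unfolding lookup_sum by (rule sum.cong[OF refl])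
    also have "\<dots> = u v"
      using that(1,4) by simp
    finally have "Poly_Mapping.lookup (\<Sum>w\<in>t. scale_free (u w) w) b = u v" .
    then show ?thesis
      using that(3) by simp
  qed
  then show ?thesis
    unfolding free_module.independent_explicit_module by blast
qed

lemma span_singles:
  fixes X :: "'b set"
  shows "free_module.span ((\<lambda>b. Poly_Mapping.single b (1::'r::comm_ring_1)) ` X) = {f. Poly_Mapping.keys f \<subseteq> X}"
proof (intro equalityI subsetI)
  fix f :: "'b \<Rightarrow>\<^sub>0 'r"
  assume "f \<in> free_module.span ((\<lambda>b. Poly_Mapping.single b 1) ` X)"
  then show "f \<in> {f. Poly_Mapping.keys f \<subseteq> X}"
  proof (induction rule: free_module.span_induct_alt)
    case (step c x y)
    then show ?case
      by (auto simp: in_keys_iff lookup_add lookup_scale_free lookup_single when_def subset_iff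
          split: if_splits)
  qed simp
next
  fix f :: "'b \<Rightarrow>\<^sub>0 'r" assume "f \<in> {f. Poly_Mapping.keys f \<subseteq> X}"
  then show "f \<in> free_module.span ((\<lambda>b. Poly_Mapping.single b 1) ` X)"
    by (subst sum_scaled_singles, intro free_module.span_sum, intro free_module.span_scale)
      (auto intro: free_module.span_base)
qed

text \<open>
  A ring homomorphism \<open>\<epsilon>\<close> to a field, applied to all coordinates, turns the spanning relation into one
  over the field, where the unit vectors are independent and the exchange lemma is available.
\<close>

lemma card_le_spanning_set:
  fixes \<epsilon> :: "'r::comm_ring_1 \<Rightarrow> 'k::field" and S :: "('b \<Rightarrow>\<^sub>0 'r) set"
  assumes add: "\<And>x y. \<epsilon> (x + y) = \<epsilon> x + \<epsilon> y" and mult: "\<And>x y. \<epsilon> (x * y) = \<epsilon> x * \<epsilon> y" and one: "\<epsilon> 1 = 1"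
    and S: "finite S" "\<And>x. x \<in> X \<Longrightarrow> Poly_Mapping.single x 1 \<in> free_module.span S"
  shows "finite X \<and> card X \<le> card S"
proof -
  interpret vs: vector_space "scale_free :: 'k \<Rightarrow> ('b \<Rightarrow>\<^sub>0 'k) \<Rightarrow> _"
    by unfold_locales (rule poly_mapping_eqI, simp add: lookup_scale_free lookup_add algebra_simps)+
  have zero: "\<epsilon> 0 = 0"
    using add[of 0 0] by (metis add_0 add_cancel_right_left)
  define E where "E = (\<lambda>f :: 'b \<Rightarrow>\<^sub>0 'r. Poly_Mapping.map \<epsilon> f)"
  have lookup_E: "Poly_Mapping.lookup (E f) b = \<epsilon> (Poly_Mapping.lookup f b)" for f b
    by (simp add: E_def map.rep_eq when_def zero)
  have E_span: "E f \<in> free_module.span (E ` S)" if "f \<in> free_module.span S" for f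
    using that
  proof (induction rule: free_module.span_induct_alt)
    case base
    have "E 0 = 0"
      by (rule poly_mapping_eqI) (simp add: lookup_E zero)
    then show ?case
      by (simp add: free_module.span_zero)
  next
    case (step c x y)
    have "E (scale_free c x + y) = scale_free (\<epsilon> c) (E x) + E y"
      by (rule poly_mapping_eqI) (simp add: lookup_E lookup_scale_free lookup_add add mult)
    then show ?case
      using step by (simp add: free_module.span_add free_module.span_scale free_module.span_base)
  qed
  let ?e = "\<lambda>b. Poly_Mapping.single b (1::'k)"
  have "E (Poly_Mapping.single x 1) = ?e x" for x
    by (rule poly_mapping_eqI) (simp add: lookup_E lookup_single when_def one zero)
  then have "?e ` X \<subseteq> free_module.span (E ` S)"
    using E_span S(2) by (metis image_subsetI)
  then have *: "finite (?e ` X) \<and> card (?e ` X) \<le> card (E ` S)"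
    using vs.independent_span_bound[of "E ` S" "?e ` X"] S(1) independent_singles[of X] by simp
  moreover have "inj_on ?e X"
    by (rule inj_onI) (metis lookup_single_eq lookup_single_not_eq zero_neq_one)
  then have "finite X \<longleftrightarrow> finite (?e ` X)" "card (?e ` X) = card X"
    by (simp_all add: finite_image_iff card_image)
  moreover have "card (E ` S) \<le> card S"
    using S(1) by (rule card_image_le)
  ultimately show ?thesis
    by simp
qed

text \<open>
  The previous bound serves twice: a basis \<open>B\<close> spans the unit vectors indexed by \<open>C\<close>, and in
  coordinates with respect to \<open>B\<close> the elements of \<open>B\<close> are unit vectors spanned by the images of those
  indexed by \<open>C\<close>.  The second use also shows that \<open>B\<close> is finite.
\<close>

lemma free_rank_eq_card:
  fixes \<epsilon> :: "'r::comm_ring_1 \<Rightarrow> 'k::field" and C :: "'b set"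
  assumes hom: "\<And>x y. \<epsilon> (x + y) = \<epsilon> x + \<epsilon> y" "\<And>x y. \<epsilon> (x * y) = \<epsilon> x * \<epsilon> y" "\<epsilon> 1 = 1"
    and C: "finite C"
  shows "free_rank {f :: 'b \<Rightarrow>\<^sub>0 'r. Poly_Mapping.keys f \<subseteq> C} = card C"
proof -
  let ?M = "{f :: 'b \<Rightarrow>\<^sub>0 'r. Poly_Mapping.keys f \<subseteq> C}"
  let ?e = "\<lambda>b. Poly_Mapping.single b (1::'r)"
  define B where "B = (SOME B. free_module.independent B \<and> free_module.span B = ?M)"
  have "\<exists>B. free_module.independent B \<and> free_module.span B = ?M"
    by (intro exI[of _ "?e ` C"] conjI independent_singles span_singles)
  then have "free_module.independent B \<and> free_module.span B = ?M"
    unfolding B_def by (rule someI_ex)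
  then have B: "free_module.independent B" "free_module.span B = ?M"
    by auto
  \<comment> \<open>The coordinate map with respect to \<open>B\<close>.\<close>
  define r where "r f = Abs_poly_mapping (free_module.representation B f)" for f
  have lookup_r: "Poly_Mapping.lookup (r f) = free_module.representation B f" for f
    using free_module.finite_representation[of B f] by (simp add: r_def Abs_poly_mapping_inverse)
  have e_B: "x \<in> free_module.span B" if "x \<in> ?e ` C" for x
    using that B(2) by auto
  have r_span: "f \<in> free_module.span B \<and> r f \<in> free_module.span (r ` ?e ` C)"
    if "f \<in> free_module.span (?e ` C)" for f
    using that
  proof (induction rule: free_module.span_induct_alt)
    case base
    have "r 0 = 0"
      by (rule poly_mapping_eqI) (simp add: lookup_r free_module.representation_zero)
    then show ?case
      by (simp add: free_module.span_zero)
  next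
    case (step c x y)
    have span_B: "x \<in> free_module.span B" "y \<in> free_module.span B"
      using step e_B by auto
    then have "r (scale_free c x + y) = scale_free c (r x) + r y"
      using B(1) by (intro poly_mapping_eqI) 
        (simp add: lookup_r lookup_scale_free lookup_add free_module.representation_add
          free_module.representation_scale free_module.span_scale)
    then show ?case
      using step span_B by (simp add: free_module.span_add free_module.span_scale free_module.span_base)
  qed
  have "Poly_Mapping.single b 1 \<in> free_module.span (r ` ?e ` C)" if b: "b \<in> B" for b
  proof -
    have "b \<in> free_module.span (?e ` C)"
      using b B(2) free_module.span_base[of b B] by (simp add: span_singles)
    moreover have "r b = Poly_Mapping.single b 1"
      using free_module.representation_basis[OF B(1) b]
      by (intro poly_mapping_eqI) (simp add: lookup_r lookup_single when_def eq_commute)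
    ultimately show ?thesis
      using r_span by metis
  qed
  then have le: "finite B \<and> card B \<le> card (r ` ?e ` C)"
    using C by (intro card_le_spanning_set[OF hom]) auto
  moreover have "card (r ` ?e ` C) \<le> card C"
    using C card_image_le[of C "r \<circ> ?e"] by (simp add: image_comp)
  moreover have "card C \<le> card B"
    using le B(2) card_le_spanning_set[OF hom, of B C] by auto
  ultimately show ?thesis
    unfolding free_rank_def B_def[symmetric] by simp
qed

text \<open>Taking the constant coefficient is multiplicative, as monomials with product \<open>1\<close> are \<open>1\<close>.\<close>

lemma free_rank_mpoly:
  fixes C :: "'b set"
  assumes "finite C"
  shows "free_rank {f :: 'b \<Rightarrow>\<^sub>0 ('x, 'k::field) mpoly. Poly_Mapping.keys f \<subseteq> C} = card C"
proof (rule free_rank_eq_card[where \<epsilon> = "\<lambda>p :: ('x, 'k) mpoly. Poly_Mapping.lookup p 0"])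
  fix p q :: "('x, 'k) mpoly"
  have split: "0 = l + n \<longleftrightarrow> l = 0 \<and> n = 0" for l n :: "'x mon"
    by (auto simp: poly_mapping_eq_iff lookup_add fun_eq_iff)
  show "Poly_Mapping.lookup (p * q) 0 = Poly_Mapping.lookup p 0 * Poly_Mapping.lookup q 0"
    unfolding lookup_mult split
    by (subst Sum_any.expand_superset[where A = "{0}"], auto simp: when_def intro: ccontr)
qed (use assms in \<open>simp_all add: lookup_add\<close>)

section \<open>Minimal generating sets\<close>

text \<open>A generator with a proper divisor in \<open>G\<close> would be redundant.\<close>

lemma minimal_generators_antichain:
  fixes I :: "('x, 'k::field) mpoly set"
  assumes "minimal_monomial_generators I G" "m \<in> G" "n \<in> G" "mon_dvd m n"
  shows "m = n"
proof (rule ccontr)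
  assume "m \<noteq> n"
  let ?S = "(monom :: _ \<Rightarrow> ('x, 'k) mpoly) ` (G - {n})"
  obtain c where "n = m + c"
    using assms(4) by (auto simp: mon_dvd_def)
  then have "(monom n :: ('x, 'k) mpoly) = monom c * monom m"
    by (simp add: monom_def mult_single add.commute)
  moreover have "monom m \<in> ?S"
    using assms(2) \<open>m \<noteq> n\<close> by auto
  ultimately have "monom n \<in> module.span (*) ?S"
    using module.span_scale[OF module_mult module.span_base[OF module_mult]] by metis
  then have "insert (monom n) ?S \<subseteq> module.span (*) ?S"
    by (simp add: module.span_superset[OF module_mult])
  moreover have "?S \<subseteq> module.span (*) (insert (monom n) ?S)"
    using module.span_superset[OF module_mult, of "insert (monom n) ?S"] by simp
  ultimately have "module.span (*) (insert (monom n) ?S) = module.span (*) ?S"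
    by (simp only: module.span_eq[OF module_mult] simp_thms)
  moreover have "insert (monom n) ?S = monom ` G"
    using assms(3) by auto
  ultimately have "ideal_generated ?S = I"
    using assms(1) by (simp add: minimal_monomial_generators_def ideal_generated_def)
  moreover have "G - {n} \<subset> G"
    using assms(3) by auto
  ultimately show False
    using assms(1) by (auto simp: minimal_monomial_generators_def)
qed

lemma bm_reaches_cofinite:
  "bm_reaches G gt \<Omega> A \<Longrightarrow> finite ({\<sigma>. \<sigma> \<subseteq> G \<and> 3 \<le> card \<sigma>} - \<Omega>)"
proof (induction rule: bm_reaches.induct)
  case (step \<Omega> A \<sigma>)
  then show ?case
    by (rule_tac finite_subset[of _ "({\<sigma>. \<sigma> \<subseteq> G \<and> 3 \<le> card \<sigma>} - \<Omega>) \<union> {\<sigma>, remove_sb gt \<sigma>}"]) auto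
qed auto

text \<open>
  The algorithm empties \<open>\<Omega>\<close> in finitely many steps, each of which removes at most two sets.  So only
  finitely many sets of generators have three elements.
\<close>

lemma barile_macchia_matching_finite:
  assumes "barile_macchia_matching G gt B"
  shows "finite G"
proof (rule ccontr)
  assume inf: "infinite G"
  have fin: "finite {\<sigma>. \<sigma> \<subseteq> G \<and> 3 \<le> card \<sigma>}"
    using assms bm_reaches_cofinite[where \<Omega> = "{}"] by (auto simp: barile_macchia_matching_def)
  obtain T where T: "finite T" "card T = 2" "T \<subseteq> G"
    using infinite_arbitrarily_large[OF inf] by blast
  then have sub: "(\<lambda>x. insert x T) ` (G - T) \<subseteq> {\<sigma>. \<sigma> \<subseteq> G \<and> 3 \<le> card \<sigma>}"
    by auto
  have "inj_on (\<lambda>x. insert x T) (G - T)"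
    by (rule inj_onI) blast
  then have "finite (G - T)"
    by (rule finite_imageD[OF finite_subset[OF sub fin]])
  then show False
    using T(1) inf by simp
qed

section \<open>The comparison for monomial ideals\<close>

theorem theorem5p13:
  fixes I :: "('x::finite, 'k::field) mpoly set"
    and G :: "'x mon set"
    and gt :: "'x mon \<Rightarrow> 'x mon \<Rightarrow> bool"
    and A_L A_B :: "('x mon set \<times> 'x mon set) set"
    and F_L F_B :: "('x, 'k) free_mod graded_complex"
  assumes "monomial_ideal I"
    and "minimal_monomial_generators I G"
    and "strict_total_order_on G gt"
    and "A_L = lyubeznik_matching G gt"
    and "barile_macchia_matching G gt A_B"
    and "F_L = morse_resolution G gt A_L"
    and "F_B = morse_resolution G gt A_B"
    and "\<not> (\<exists>\<sigma> \<tau> s t m. \<sigma> \<subseteq> G \<and> \<tau> \<subseteq> G \<and>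
            sb gt \<sigma> = Some s \<and> sb gt \<tau> = Some t \<and>
            m_L G gt \<sigma> = Some m \<and> m_L G gt \<tau> = Some m \<and>
            \<sigma> - {s} = \<tau> - {t} \<and> gt t s \<and> gt m t \<and> m \<in> \<tau>)"
  shows "Field A_L \<subseteq> Field A_B \<and>
         (\<forall>i::int. free_rank (component F_L i) \<ge> free_rank (component F_B i))"
proof -
  interpret ordered_generators G gt
    using barile_macchia_matching_finite[OF assms(5)] assms(3)
      minimal_generators_antichain[OF assms(2)]
    by unfold_locales auto
  have sub: "Field A_L \<subseteq> Field A_B"
    unfolding assms(4)
  proof (rule Field_lyubeznik_subset_Field_barile_macchia[OF assms(5)])
    fix \<sigma> \<tau> s t m
    assume "\<sigma> \<subseteq> G" "\<tau> \<subseteq> G" "sb gt \<sigma> = Some s" "sb gt \<tau> = Some t" "m_L G gt \<sigma> = Some m"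
      "m_L G gt \<tau> = Some m" "\<sigma> - {s} = \<tau> - {t}" "gt t s" "gt m t" "m \<in> \<tau>"
    show False
      by (rule notE[OF assms(8)], intro exI[of _ \<sigma>] exI[of _ \<tau>] exI[of _ s] exI[of _ t] exI[of _ m] conjI) fact+
  qed
  have finite_critical: "finite (critical G A i)" for A :: "('x mon set \<times> 'x mon set) set" and i
    by (rule finite_subset[of _ "Pow G"]) (auto simp: critical_def finite_G)
  have rank: "free_rank (component (morse_resolution G gt A :: ('x, 'k) free_mod graded_complex) i)
      = card (critical G A i)" for A i
    using free_rank_mpoly[OF finite_critical] by (simp add: morse_resolution_def)
  have "free_rank (component F_B i) \<le> free_rank (component F_L i)" for i
  proof -
    have "critical G A_B i \<subseteq> critical G A_L i"
      using sub by (auto simp: critical_def)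
    then have "card (critical G A_B i) \<le> card (critical G A_L i)"
      by (rule card_mono[OF finite_critical])
    then show ?thesis
      by (simp only: rank assms(6,7))
  qed
  then show ?thesis
    using sub by simp
qed

end
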